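(* Let $\lambda>0$ and $x_0\in\mathbb{R}^d$, define the measure $$\mu(C)=\mathbb{E}^{x_0}\int_0^\infty e^{-\lambda t}1_C(X_t)\,dt\qquad (C\subseteq\mathbb{R}^d\text{ Borel}),$$ and for $\varepsilon>0$ let $$n^\varepsilon(x,h)=\frac{\int\varphi_\varepsilon(x-y)\,n(y,h)\,\mu(dy)}{\int\varphi_\varepsilon(x-y)\,\mu(dy)} .$$ Then for each fixed $h\in\mathbb{R}^d\setminus\{0\}$, $n^\varepsilon(x,h)\to n(x,h)$ as $\varepsilon\to0$ for almost every $x$ (with respect to Lebesgue measure).
   Context: Setting. Let $n(x,h)$ be a function of $x\in\mathbb{R}^d$, $h\in\mathbb{R}^d\setminus\{0\}$, and for $f\in C^2(\mathbb{R}^d)$ bounded with bounded first and second partial derivatives set $$\mathcal{L}f(x)=\int_{\mathbb{R}^d\setminus\{0\}}\left[f(x+h)-f(x)-\nabla f(x)\cdot h\,1_{(|h|\le 1)}\right]n(x,h)\,dh .$$ Standing assumptions on $n$: (a) $n(x,-h)=n(x,h)$ for all $x,h$; (b) there are constants $\kappa\in(0,1)$ and $\alpha\in(0,2)$ such that $\kappa|h|^{-d-\alpha}\le n(x,h)\le\kappa^{-1}|h|^{-d-\alpha}$ for all $x,h$; (c) for $\eta>0$ let $\psi_\eta(r)=(1+\log^+(1/r))^{1+\eta}$, $r>0$, and $\bar n(x,h)=n(x,h)\psi_\eta(|h|)$; there exists $\eta>0$ such that for every $y\in\mathbb{R}^d$ and every $b>0$, $\lim_{x\to y}\sup_{|h|\le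 b}|\bar n(x,h)-\bar n(y,h)|=0$. A probability measure $\mathbb{P}$ solves the martingale problem for $\mathcal{L}$ started at $x$ if $\mathbb{P}(X_0=x)=1$ and, for every $f\in C^2$ bounded with bounded first and second partial derivatives, $f(X_t)-f(X_0)-\int_0^t\mathcal{L}f(X_s)\,ds$ is a $\mathbb{P}$-martingale. It is assumed given that $(\mathbb{P}^x,X_t)$ is a strong Markov process with state space $\mathbb{R}^d$ (with right-continuous paths with left limits) such that for every $x$ the measure $\mathbb{P}^x$ is a solution to the martingale problem for $\mathcal{L}$ started at $x$; $\mathbb{E}^x$ is the corresponding expectation. Mollifier: $\varphi:\mathbb{R}^d\to[0,\infty)$ is a $C^\infty$, radially symmetric function with compact support such that $\int_{\mathbb{R}^d}\varphi=1$ and $\varphi>0$ on $\{|x|<r\}$ for some $r>0$; $\varphi_\varepsilon(x)=\varepsilon^{-d}\varphi(x/\varepsilon)$. *)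

theory Defs
  imports "HOL-Probability.Probability"
begin

section \<open>Differentiable functions on a Euclidean space\<close>

definition partial_deriv :: "'a::euclidean_space \<Rightarrow> ('a \<Rightarrow> real) \<Rightarrow> 'a \<Rightarrow> real" where
  "partial_deriv i f x = frechet_derivative f (at x) i"

definition grad :: "('a::euclidean_space \<Rightarrow> real) \<Rightarrow> 'a \<Rightarrow> 'a" where
  "grad f x = (\<Sum>i\<in>Basis. partial_deriv i f x *\<^sub>R i)"

text \<open>Total differentiability is demanded at each stage, so that \<^const>\<open>frechet_derivative\<close> is never
  an arbitrary value; since the last partial derivatives are required to be continuous, this is
  the usual class of \<open>k\<close> times continuously differentiable functions.\<close>

primrec C_class :: "nat \<Rightarrow> ('a::euclidean_space \<Rightarrow> real) \<Rightarrow> bool" where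
  "C_class 0 f \<longleftrightarrow> continuous_on UNIV f"
| "C_class (Suc k) f \<longleftrightarrow>
     (\<forall>x. f differentiable (at x)) \<and> (\<forall>i\<in>Basis. C_class k (partial_deriv i f))"

definition C2_bounded :: "('a::euclidean_space \<Rightarrow> real) \<Rightarrow> bool" where
  "C2_bounded f \<longleftrightarrow> C_class 2 f \<and> bounded (range f) \<and>
     (\<forall>i\<in>Basis. bounded (range (partial_deriv i f))) \<and>
     (\<forall>i\<in>Basis. \<forall>j\<in>Basis. bounded (range (partial_deriv j (partial_deriv i f))))"

section \<open>The operator\<close>

definition jump_operator ::
  "('a::euclidean_space \<Rightarrow> 'a \<Rightarrow> real) \<Rightarrow> ('a \<Rightarrow> real) \<Rightarrow> 'a \<Rightarrow> real" where
  "jump_operator n f x =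
     (LINT h:-{0}|lborel.
        (f (x + h) - f x - (grad f x \<bullet> h) * indicator {h. norm h \<le> 1} h) * n x h)"

definition log_weight :: "real \<Rightarrow> real \<Rightarrow> real" where
  "log_weight \<eta> r = (1 + max 0 (ln (1 / r))) powr (1 + \<eta>)"

text \<open>The supremum is taken in \<^typ>\<open>ennreal\<close>, where it is meaningful even if it is infinite.\<close>

definition weighted_kernel_continuous ::
  "real \<Rightarrow> ('a::euclidean_space \<Rightarrow> 'a \<Rightarrow> real) \<Rightarrow> bool" where
  "weighted_kernel_continuous \<eta> n \<longleftrightarrow>
     (\<forall>y. \<forall>b>0.
        ((\<lambda>x. SUP h\<in>{h. h \<noteq> 0 \<and> norm h \<le> b}.
             ennreal \<bar>n x h * log_weight \<eta> (norm h) - n y h * log_weight \<eta> (norm h)\<bar>)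
           \<longlongrightarrow> 0) (at y))"

section \<open>Processes\<close>

text \<open>A process is a family \<open>X t\<close> of which only the times \<open>t \<ge> 0\<close> matter.  Filtrations are indexed by
  \<open>[0,\<infinity>]\<close>, i.e. by \<^typ>\<open>ennreal\<close>, so that the library's \<^const>\<open>stopping_time\<close> and
  \<^const>\<open>filtration.pre_sigma\<close> apply to stopping times that may be infinite.  A filtration
  indexed by \<open>[0,\<infinity>)\<close> extends, e.g. by the whole \<open>\<sigma>\<close>-algebra at \<open>\<infinity>\<close>.\<close>

definition rcll :: "(real \<Rightarrow> 'a::topological_space) \<Rightarrow> bool" where
  "rcll p \<longleftrightarrow> (\<forall>t\<ge>0. (p \<longlongrightarrow> p t) (at_right t)) \<and> (\<forall>t>0. \<exists>l. (p \<longlongrightarrow> l) (at_left t))"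

definition martingale ::
  "'w measure \<Rightarrow> (ennreal \<Rightarrow> 'w measure) \<Rightarrow> (real \<Rightarrow> 'w \<Rightarrow> real) \<Rightarrow> bool" where
  "martingale Q F Z \<longleftrightarrow>
     (\<forall>t\<ge>0. Z t \<in> borel_measurable (F (ennreal t)) \<and> integrable Q (Z t)) \<and>
     (\<forall>s\<ge>0. \<forall>t\<ge>s. AE \<omega> in Q. real_cond_exp Q (F (ennreal s)) (Z t) \<omega> = Z s \<omega>)"

definition solves_martingale_problem ::
  "('a::euclidean_space \<Rightarrow> 'a \<Rightarrow> real) \<Rightarrow> (ennreal \<Rightarrow> 'w measure) \<Rightarrow> (real \<Rightarrow> 'w \<Rightarrow> 'a)
     \<Rightarrow> 'w measure \<Rightarrow> 'a \<Rightarrow> bool" where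
  "solves_martingale_problem n F X Q x \<longleftrightarrow>
     prob_space Q \<and> measure Q {\<omega> \<in> space Q. X 0 \<omega> = x} = 1 \<and>
     (\<forall>f. C2_bounded f \<longrightarrow>
        martingale Q F (\<lambda>t \<omega>. f (X t \<omega>) - f (X 0 \<omega>)
                                - (LINT s:{0..t}|lborel. jump_operator n f (X s \<omega>))))"

text \<open>The last clause is the strong Markov property
  \<open>P\<^sup>x(X\<^bsub>T+t\<^esub> \<in> B | F\<^sub>T) = P\<^bsup>X(T)\<^esup>(X\<^sub>t \<in> B)\<close> almost surely on \<open>{T < \<infinity>}\<close>.\<close>

definition strong_Markov_process ::
  "'w measure \<Rightarrow> (ennreal \<Rightarrow> 'w measure) \<Rightarrow> ('a::euclidean_space \<Rightarrow> 'w measure)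
     \<Rightarrow> (real \<Rightarrow> 'w \<Rightarrow> 'a) \<Rightarrow> bool" where
  "strong_Markov_process M F P X \<longleftrightarrow>
     filtration (space M) F \<and> (\<forall>t. subalgebra M (F t)) \<and>
     (\<forall>x. prob_space (P x) \<and> sets (P x) = sets M) \<and>
     (\<forall>t\<ge>0. X t \<in> measurable (F (ennreal t)) borel) \<and>
     (\<forall>\<omega>\<in>space M. rcll (\<lambda>t. X t \<omega>)) \<and>
     (\<forall>t\<ge>0. \<forall>B\<in>sets borel.
        (\<lambda>x. measure (P x) {\<omega> \<in> space M. X t \<omega> \<in> B}) \<in> borel_measurable borel) \<and>
     (\<forall>x T. stopping_time F T \<longrightarrow>
        (\<forall>t\<ge>0. \<forall>B\<in>sets borel. AE \<omega> in P x. T \<omega> < \<infinity> \<longrightarrow>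
           real_cond_exp (P x) (filtration.pre_sigma (space M) F T)
             (\<lambda>\<omega>'. if T \<omega>' < \<infinity> then indicator B (X (enn2real (T \<omega>') + t) \<omega>') else 0) \<omega>
           = measure (P (X (enn2real (T \<omega>)) \<omega>)) {\<omega>' \<in> space M. X t \<omega>' \<in> B}))"

definition resolvent_measure ::
  "'w measure \<Rightarrow> (real \<Rightarrow> 'w \<Rightarrow> 'a::euclidean_space) \<Rightarrow> real \<Rightarrow> 'a measure" where
  "resolvent_measure Q X lam =
     measure_of UNIV (sets borel)
       (\<lambda>C. \<integral>\<^sup>+\<omega>. (\<integral>\<^sup>+t\<in>{0..}. ennreal (exp (- lam * t)) * indicator C (X t \<omega>) \<partial>lborel) \<partial>Q)"

section \<open>Mollification\<close>

definition is_mollifier :: "('a::euclidean_space \<Rightarrow> real) \<Rightarrow> bool" where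
  "is_mollifier \<phi> \<longleftrightarrow>
     (\<forall>k. C_class k \<phi>) \<and> (\<forall>x. \<phi> x \<ge> 0) \<and> (\<forall>x y. norm x = norm y \<longrightarrow> \<phi> x = \<phi> y) \<and>
     compact (closure {x. \<phi> x \<noteq> 0}) \<and> (LINT x|lborel. \<phi> x) = 1 \<and>
     (\<exists>r>0. \<forall>x. norm x < r \<longrightarrow> \<phi> x > 0)"

definition mollifier_scale :: "('a::euclidean_space \<Rightarrow> real) \<Rightarrow> real \<Rightarrow> 'a \<Rightarrow> real" where
  "mollifier_scale \<phi> \<epsilon> x = (1 / \<epsilon>) ^ DIM('a) * \<phi> (x /\<^sub>R \<epsilon>)"

definition mollified_kernel ::
  "('a::euclidean_space \<Rightarrow> real) \<Rightarrow> 'a measure \<Rightarrow> ('a \<Rightarrow> 'a \<Rightarrow> real) \<Rightarrow> real \<Rightarrow> 'a \<Rightarrow> 'a \<Rightarrow> real" where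
  "mollified_kernel \<phi> \<mu> n \<epsilon> x h =
     (LINT y|\<mu>. mollifier_scale \<phi> \<epsilon> (x - y) * n y h) / (LINT y|\<mu>. mollifier_scale \<phi> \<epsilon> (x - y))"

end

theory Submission
  imports Defs
begin

text \<open>For fixed \<open>h\<close> the function \<open>y \<mapsto> n y h\<close> is continuous and bounded, so its averages against
  \<open>\<phi>\<^sub>\<epsilon>(x - y) \<mu>(dy)\<close> converge to \<open>n x h\<close> as soon as \<open>x\<close> lies in the support of \<open>\<mu>\<close>.  In fact every
  point does.  If \<open>\<mu>\<close> did not charge a ball, right-continuity would keep almost every path out of
  it for all times.  For a bump function \<open>f\<close> supported well inside the ball, \<open>f (X t)\<close> then vanishes
  identically, so that \<open>\<integral>\<^sub>0\<^sup>1 L f (X s) ds\<close> has mean zero, whereas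
  \<open>L f x = \<integral> f (x + h) n x h dh > 0\<close> for all \<open>x\<close> outside the ball, because \<open>n\<close> is positive.\<close>

section \<open>Null open sets and continuity of the kernel in its first argument\<close>

text \<open>Nonempty open sets have positive Lebesgue measure. This closes every argument below in
  which a vanishing integral, over time or over jumps, must be contradicted by a single point of an
  open set.\<close>

lemma open_AE_lborel_empty:
  fixes U :: "'a::euclidean_space set"
  assumes "open U" and "AE x in lborel. x \<notin> U"
  shows "U = {}"
proof -
  have "U \<in> null_sets lborel"
    using assms by (subst AE_iff_null_sets) auto
  then have "negligible U"
    by (simp add: negligible_iff_null_sets null_sets_completionI)
  then show ?thesis
    using open_not_negligible[OF assms(1)] by blast
qed

text \<open>With \<open>b = norm h\<close> the supremum dominates its own term at \<open>h\<close>,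
  and there the weight is a positive constant independent of \<open>x\<close> that can be divided
  out.\<close>

lemma weighted_kernel_continuous_isCont:
  assumes "\<eta> > 0" and "weighted_kernel_continuous \<eta> n" and "h \<noteq> 0"
  shows "isCont (\<lambda>x. n x h) y"
proof -
  define c where "c = log_weight \<eta> (norm h)"
  have c: "c > 0"
    unfolding c_def log_weight_def by (simp add: add_pos_nonneg)
  have "((\<lambda>x. SUP h'\<in>{h'. h' \<noteq> 0 \<and> norm h' \<le> norm h}.
             ennreal \<bar>n x h' * log_weight \<eta> (norm h') - n y h' * log_weight \<eta> (norm h')\<bar>)
           \<longlongrightarrow> 0) (at y)"
    using assms unfolding weighted_kernel_continuous_def by auto
  then have "((\<lambda>x. ennreal \<bar>n x h * c - n y h * c\<bar>) \<longlongrightarrow> 0) (at y)"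
    unfolding c_def
    by (rule tendsto_sandwich[rotated 2, OF tendsto_const])
       (use assms(3) in \<open>auto intro!: always_eventually SUP_upper2[where i = h]\<close>)
  then have "((\<lambda>x. \<bar>n x h * c - n y h * c\<bar>) \<longlongrightarrow> 0) (at y)"
    by (simp flip: ennreal_0)
  then have "((\<lambda>x. n x h * c - n y h * c) \<longlongrightarrow> 0) (at y)"
    by (simp add: tendsto_rabs_zero_iff)
  then have "((\<lambda>x. n x h * c) \<longlongrightarrow> n y h * c) (at y)"
    by (simp add: LIM_zero_iff)
  then have "((\<lambda>x. n x h * c / c) \<longlongrightarrow> n y h * c / c) (at y)"
    using c by (intro tendsto_divide) auto
  then show ?thesis
    using c by (simp add: isCont_def)
qed

section \<open>Smooth functions: rescaling, compact support and mollifiers\<close>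

lemma C_class_continuous: "C_class k f \<Longrightarrow> continuous_on UNIV f"
  by (cases k) (auto simp: differentiable_imp_continuous_within continuous_at_imp_continuous_on)

text \<open>The chain rule multiplies the prefactor by \<open>a\<close> and replaces
  \<open>g\<close> by its partial derivative. Carrying the prefactor \<open>c\<close> keeps the form
  closed under differentiation, so that \<open>C_class_affine\<close> follows by induction with
  \<open>g\<close> and \<open>c\<close> arbitrary.\<close>

lemma partial_deriv_affine:
  assumes "\<And>x. g differentiable (at x)"
  shows "partial_deriv i (\<lambda>x. c * g (a *\<^sub>R (x - z))) =
    (\<lambda>x. (c * a) * partial_deriv i g (a *\<^sub>R (x - z)))"
proof
  fix x
  define D where "D = frechet_derivative g (at (a *\<^sub>R (x - z)))"
  have D: "(g has_derivative D) (at (a *\<^sub>R (x - z)))"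
    using assms frechet_derivative_works D_def by blast
  have "((\<lambda>x. g (a *\<^sub>R (x - z))) has_derivative (\<lambda>v. D (a *\<^sub>R v))) (at x)"
    by (rule has_derivative_compose[where g = g and g' = D])
       (auto intro!: derivative_eq_intros simp: D)
  then have "((\<lambda>x. c * g (a *\<^sub>R (x - z))) has_derivative (\<lambda>v. c * D (a *\<^sub>R v))) (at x)"
    by (rule has_derivative_mult_right)
  then have "frechet_derivative (\<lambda>x. c * g (a *\<^sub>R (x - z))) (at x) = (\<lambda>v. c * D (a *\<^sub>R v))"
    by (rule frechet_derivative_at[symmetric])
  moreover have "D (a *\<^sub>R i) = a * D i"
    using has_derivative_bounded_linear[OF D] by (simp add: linear_simps)
  ultimately show "partial_deriv i (\<lambda>x. c * g (a *\<^sub>R (x - z))) x =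
      (c * a) * partial_deriv i g (a *\<^sub>R (x - z))"
    by (simp add: partial_deriv_def D_def)
qed

lemma C_class_affine:
  "C_class k g \<Longrightarrow> C_class k (\<lambda>x. c * g (a *\<^sub>R (x - z)))"
proof (induction k arbitrary: g c)
  case 0
  then show ?case
    by (auto intro!: continuous_intros continuous_on_compose2[of UNIV g])
next
  case (Suc k)
  then have d: "\<And>x. g differentiable (at x)" by simp
  have "(\<lambda>x. g (a *\<^sub>R (x - z))) differentiable (at x)" for x
    using differentiable_chain_at[of "\<lambda>x. a *\<^sub>R (x - z)" x g] d by (simp add: o_def)
  then show ?case
    using Suc d by (simp add: partial_deriv_affine)
qed

lemma frechet_derivative_locally_zero:
  assumes "open U" "x \<in> U" "\<And>y. y \<in> U \<Longrightarrow> f y = (0::real)"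
  shows "frechet_derivative f (at x) = (\<lambda>_. 0)"
proof -
  have "(f has_derivative (\<lambda>_. 0)) (at x)"
    by (rule has_derivative_transform_within_open[OF has_derivative_const assms(1,2)])
       (simp add: assms(3))
  then show ?thesis
    by (rule frechet_derivative_at[symmetric])
qed

lemma partial_deriv_support:
  assumes "\<And>x. x \<notin> K \<Longrightarrow> f x = 0" "closed K" "x \<notin> K"
  shows "partial_deriv i f x = 0"
  using frechet_derivative_locally_zero[of "- K" x f] assms by (simp add: partial_deriv_def open_Compl)

lemma bounded_range_compact_support:
  fixes f :: "'a::euclidean_space \<Rightarrow> real"
  assumes "continuous_on UNIV f" "compact K" "\<And>x. x \<notin> K \<Longrightarrow> f x = 0"
  shows "bounded (range f)"
proof -
  have "bounded (insert 0 (f ` K))"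
    using assms(1,2) compact_continuous_image compact_imp_bounded continuous_on_subset
    by (metis bounded_insert subset_UNIV)
  then show ?thesis
    by (rule bounded_subset) (use assms(3) in auto)
qed

text \<open>The complement of \<open>K\<close> is open, so derivatives vanish off the same
  \<open>K\<close>, and a continuous function that vanishes off a compact set is bounded. This
  admits rescaled mollifiers as test functions in the martingale problem.\<close>

lemma C2_bounded_compact_support:
  assumes "C_class 2 f" "compact K" "\<And>x. x \<notin> K \<Longrightarrow> f x = 0"
  shows "C2_bounded f"
proof -
  \<comment> \<open>The successor form lets the recursive equations of \<open>C_class\<close>
    unfold.\<close>
  have C: "C_class (Suc (Suc 0)) f"
    using assms(1) by (simp only: numeral_2_eq_2)
  have K: "closed K"
    using assms(2) compact_imp_closed by blast
  have 1: "partial_deriv i f x = 0" if "x \<notin> K" for i x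
    using partial_deriv_support[of K f] assms(3) K that by blast
  have 2: "partial_deriv j (partial_deriv i f) x = 0" if "x \<notin> K" for i j x
    using partial_deriv_support[of K "partial_deriv i f"] 1 K that by blast
  have C1: "C_class (Suc 0) (partial_deriv i f)" if "i \<in> Basis" for i
    using C that by simp
  then have C0: "C_class 0 (partial_deriv j (partial_deriv i f))" if "i \<in> Basis" "j \<in> Basis" for i j
    using that by simp
  have "bounded (range f)"
    by (rule bounded_range_compact_support[OF C_class_continuous[OF C] assms(2,3)])
  moreover have "bounded (range (partial_deriv i f))" if "i \<in> Basis" for i
    by (rule bounded_range_compact_support[OF C_class_continuous[OF C1[OF that]] assms(2) 1])
  moreover have "bounded (range (partial_deriv j (partial_deriv i f)))"
    if "i \<in> Basis" "j \<in> Basis" for i j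
    by (rule bounded_range_compact_support[OF C_class_continuous[OF C0[OF that]] assms(2) 2])
  ultimately show ?thesis
    using assms(1) unfolding C2_bounded_def by blast
qed

text \<open>The mollifier is used twice, as an averaging weight and as a bump function. Both uses
  rest on these data: a radius \<open>R\<close> for its support, an upper bound \<open>K\<close>,
  and a radius \<open>r\<close> of strict positivity.\<close>

lemma mollifier_properties:
  assumes "is_mollifier \<phi>"
  obtains R K r where "R > 0" "\<And>x. \<phi> x \<noteq> 0 \<Longrightarrow> norm x \<le> R" "\<And>x. \<phi> x \<le> K"
    "continuous_on UNIV \<phi>" "\<And>x. \<phi> x \<ge> 0" "r > 0" "\<And>x. norm x < r \<Longrightarrow> \<phi> x > 0"
proof -
  have c: "continuous_on UNIV \<phi>"
    using assms C_class_continuous unfolding is_mollifier_def by blast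
  have cpt: "compact (closure {x. \<phi> x \<noteq> 0})"
    using assms unfolding is_mollifier_def by blast
  obtain R where R: "R > 0" "\<And>x. \<phi> x \<noteq> 0 \<Longrightarrow> norm x \<le> R"
    using compact_imp_bounded[OF cpt] subsetD[OF closure_subset] unfolding bounded_pos
    by (metis (mono_tags, lifting) mem_Collect_eq)
  have "bounded (range \<phi>)"
    using subsetD[OF closure_subset, of _ "{x. \<phi> x \<noteq> 0}"]
    by (intro bounded_range_compact_support[OF c cpt]) auto
  then obtain K where K: "\<And>x. \<phi> x \<le> K"
    unfolding bounded_iff by (metis abs_le_D1 rangeI real_norm_def)
  have "\<exists>r>0. \<forall>x. norm x < r \<longrightarrow> \<phi> x > 0"
    using assms unfolding is_mollifier_def by (elim conjE) assumption
  then obtain r where r: "r > 0" "\<And>x. norm x < r \<Longrightarrow> \<phi> x > 0"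
    by blast
  have "\<forall>x. \<phi> x \<ge> 0"
    using assms unfolding is_mollifier_def by (elim conjE) assumption
  then have nonneg: "\<phi> x \<ge> 0" for x ..
  show thesis
    by (rule that[OF R K c nonneg r])
qed

section \<open>Averages at points of the support\<close>

text \<open>For small \<epsilon> the quotient is a weighted mean of values of \<open>g\<close> close
  to \<open>x\<close>. The hypothesis \<open>pos\<close> keeps the denominator positive; otherwise
  the quotient could take the default value 0 of division by zero.\<close>

lemma mollified_average_tendsto:
  fixes g :: "'a::euclidean_space \<Rightarrow> real"
  assumes "finite_measure \<mu>" and sets: "sets \<mu> = sets borel"
    and \<phi>: "is_mollifier \<phi>"
    and g: "g \<in> borel_measurable borel" "\<And>y. \<bar>g y\<bar> \<le> C" "isCont g x"
    and pos: "\<And>r. r > 0 \<Longrightarrow> emeasure \<mu> (ball x r) > 0"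
  shows "((\<lambda>\<epsilon>. (LINT y|\<mu>. mollifier_scale \<phi> \<epsilon> (x - y) * g y) /
             (LINT y|\<mu>. mollifier_scale \<phi> \<epsilon> (x - y))) \<longlongrightarrow> g x) (at_right 0)"
proof (rule tendstoI)
  interpret finite_measure \<mu> by fact
  fix e :: real assume e: "e > 0"
  obtain R K r where \<phi>: "R > 0" "\<And>x. \<phi> x \<noteq> 0 \<Longrightarrow> norm x \<le> R" "\<And>x. \<phi> x \<le> K"
    "continuous_on UNIV \<phi>" "\<And>x. \<phi> x \<ge> 0" "r > 0" "\<And>x. norm x < r \<Longrightarrow> \<phi> x > 0"
    using mollifier_properties[OF \<phi>] by metis
  obtain \<delta> where \<delta>: "\<delta> > 0" "\<And>y. dist y x < \<delta> \<Longrightarrow> dist (g y) (g x) < e / 2"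
    using g(3) e unfolding continuous_at_eps_delta by (metis half_gt_zero)
  \<comment> \<open>The weight lives within distance \<open>\<epsilon> * R\<close> of
    \<open>x\<close>, so the second condition places it where \<open>g\<close> differs from
    \<open>g x\<close> by less than \<open>e / 2\<close>.\<close>
  have *: "dist ((LINT y|\<mu>. mollifier_scale \<phi> \<epsilon> (x - y) * g y) /
             (LINT y|\<mu>. mollifier_scale \<phi> \<epsilon> (x - y))) (g x) < e" if \<epsilon>: "0 < \<epsilon>" "\<epsilon> * R < \<delta>" for \<epsilon>
  proof -
    define w where "w y = mollifier_scale \<phi> \<epsilon> (x - y)" for y
    have scale: "norm (v /\<^sub>R \<epsilon>) = norm v / \<epsilon>" for v :: 'a
      using \<epsilon> by (simp add: divide_inverse mult.commute)
    have w0: "w y \<ge> 0" for y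
      using \<phi>(5) \<epsilon> by (simp add: w_def mollifier_scale_def)
    have wK: "w y \<le> (1 / \<epsilon>) ^ DIM('a) * K" for y
      using \<phi>(3) \<epsilon> by (auto simp: w_def mollifier_scale_def intro!: mult_left_mono)
    have "continuous_on UNIV w"
      unfolding w_def[abs_def] mollifier_scale_def
      by (auto intro!: continuous_intros continuous_on_compose2[OF \<phi>(4)])
    then have [measurable]: "w \<in> borel_measurable \<mu>"
      using sets by (simp add: borel_measurable_continuous_onI cong: measurable_cong_sets)
    have [measurable]: "g \<in> borel_measurable \<mu>"
      using sets g(1) by (simp cong: measurable_cong_sets)
    have iw: "integrable \<mu> w"
      using w0 wK by (intro integrable_const_bound[where B="(1 / \<epsilon>) ^ DIM('a) * K"]) auto
    have iwg: "integrable \<mu> (\<lambda>y. w y * g y)"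
    proof (rule Bochner_Integration.integrable_bound[where f="\<lambda>y. C * w y"])
      show "AE y in \<mu>. norm (w y * g y) \<le> norm (C * w y)"
      proof (rule AE_I2)
        fix y
        have "\<bar>g y\<bar> \<le> \<bar>C\<bar>" using g(2)[of y] by simp
        then show "norm (w y * g y) \<le> norm (C * w y)"
          using w0[of y] mult_right_mono[of "\<bar>g y\<bar>" "\<bar>C\<bar>" "w y"] by (simp add: abs_mult mult.commute)
      qed
    qed (use iw in auto)
    \<comment> \<open>A zero integral would make \<open>w\<close> vanish almost everywhere, but
      \<open>w\<close> is positive on the ball of radius \<open>r * \<epsilon>\<close>, which \<mu>
      charges.\<close>
    have pos_int: "(LINT y|\<mu>. w y) > 0"
    proof (rule ccontr)
      assume "\<not> (LINT y|\<mu>. w y) > 0"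
      then have "(LINT y|\<mu>. w y) = 0"
        using Bochner_Integration.integral_nonneg[of \<mu> w, OF w0] by linarith
      then have "AE y in \<mu>. w y = 0"
        using integral_nonneg_eq_0_iff_AE[OF iw] w0 by simp
      then have "AE y in \<mu>. y \<notin> ball x (r * \<epsilon>)"
      proof (rule AE_mp, intro AE_I2 impI notI)
        fix y assume y: "w y = 0" "y \<in> ball x (r * \<epsilon>)"
        then have "norm ((x - y) /\<^sub>R \<epsilon>) < r"
          unfolding scale using \<epsilon> by (simp add: dist_norm pos_divide_less_eq)
        then have "w y > 0"
          using \<phi>(7) \<epsilon> by (simp add: w_def mollifier_scale_def)
        then show False using y by simp
      qed
      then have "emeasure \<mu> (ball x (r * \<epsilon>)) = 0"
        using sets by (subst (asm) AE_iff_measurable[where N="ball x (r * \<epsilon>)"])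
           (auto simp: sets_eq_imp_space_eq[OF sets])
      then show False
        using pos[of "r * \<epsilon>"] \<phi>(6) \<epsilon> by simp
    qed
    have bound: "\<bar>w y * g y - w y * g x\<bar> \<le> w y * (e / 2)" for y
    proof (cases "w y = 0")
      case False
      then have "norm ((x - y) /\<^sub>R \<epsilon>) \<le> R"
        using \<phi>(2)[of "(x - y) /\<^sub>R \<epsilon>"] unfolding w_def mollifier_scale_def by fastforce
      then have "norm (x - y) \<le> R * \<epsilon>"
        unfolding scale using \<epsilon>(1) by (simp add: pos_divide_le_eq)
      then have "dist y x < \<delta>"
        using \<epsilon>(2) by (simp add: dist_norm norm_minus_commute mult.commute)
      then have "\<bar>g y - g x\<bar> \<le> e / 2"
        using \<delta>(2) by (force simp: dist_real_def)
      then have "w y * \<bar>g y - g x\<bar> \<le> w y * (e / 2)"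
        using w0 by (intro mult_left_mono) auto
      then show ?thesis
        using w0[of y] by (simp add: abs_mult flip: right_diff_distrib)
    qed simp
    have "\<bar>(LINT y|\<mu>. w y * g y) - g x * (LINT y|\<mu>. w y)\<bar> = \<bar>LINT y|\<mu>. w y * g y - w y * g x\<bar>"
      using iw iwg by (simp add: mult.commute)
    also have "\<dots> \<le> (LINT y|\<mu>. w y * (e / 2))"
      using bound iw iwg by (intro integral_abs_bound[THEN order_trans] integral_mono) auto
    also have "\<dots> = (LINT y|\<mu>. w y) * (e / 2)"
      by simp
    \<comment> \<open>The factor one half in \<open>e / 2\<close> buys the strict
      inequality.\<close>
    also have "\<dots> < (LINT y|\<mu>. w y) * e"
      using pos_int e by simp
    finally have less: "\<bar>(LINT y|\<mu>. w y * g y) - g x * (LINT y|\<mu>. w y)\<bar> < (LINT y|\<mu>. w y) * e" .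
    have "(LINT y|\<mu>. w y * g y) / (LINT y|\<mu>. w y) - g x =
        ((LINT y|\<mu>. w y * g y) - g x * (LINT y|\<mu>. w y)) / (LINT y|\<mu>. w y)"
      using pos_int by (simp add: diff_divide_distrib)
    then show ?thesis
      using less pos_int unfolding w_def[symmetric] dist_real_def
      by (simp add: abs_divide pos_divide_less_eq mult.commute)
  qed
  have "eventually (\<lambda>\<epsilon>. 0 < \<epsilon> \<and> \<epsilon> < \<delta> / R) (at_right 0)"
    using \<delta>(1) \<phi>(1) by (intro eventually_at_rightI[where b="\<delta> / R"]) auto
  then show "eventually (\<lambda>\<epsilon>. dist ((LINT y|\<mu>. mollifier_scale \<phi> \<epsilon> (x - y) * g y) /
             (LINT y|\<mu>. mollifier_scale \<phi> \<epsilon> (x - y))) (g x) < e) (at_right 0)"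
    by (rule eventually_mono) (use * \<phi>(1) in \<open>auto simp: field_simps\<close>)
qed

section \<open>The resolvent measure\<close>

text \<open>Each path is the limit of its values at grid times approaching from the right, and each
  approximation is jointly measurable. Freezing the process before time 0 by \<open>max 0 t\<close>
  gives a function on the whole line.\<close>

lemma right_continuous_pair_measurable:
  fixes X :: "real \<Rightarrow> 'w \<Rightarrow> 'a::metric_space"
  assumes X: "\<And>t. t \<ge> 0 \<Longrightarrow> X t \<in> borel_measurable M"
    and rc: "\<And>\<omega> t. \<omega> \<in> space M \<Longrightarrow> t \<ge> 0 \<Longrightarrow> ((\<lambda>s. X s \<omega>) \<longlongrightarrow> X t \<omega>) (at_right t)"
  shows "(\<lambda>(\<omega>, t). X (max 0 t) \<omega>) \<in> borel_measurable (M \<Otimes>\<^sub>M borel)"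
proof -
  \<comment> \<open>The grid time for \<open>t\<close> is \<open>(c k t + 1) / Suc k\<close>. Adding
    1 to the floor puts it strictly to the right of \<open>max 0 t\<close>, at distance at most
    \<open>1 / Suc k\<close>, so that right-continuity applies.\<close>
  define c where "c k t = \<lfloor>max 0 t * real (Suc k)\<rfloor>" for k :: nat and t :: real
  have c: "max 0 t < (real_of_int (c k t) + 1) / real (Suc k)"
    "(real_of_int (c k t) + 1) / real (Suc k) \<le> max 0 t + 1 / real (Suc k)" for k t
  proof -
    have "max 0 t * real (Suc k) < real_of_int (c k t) + 1"
      unfolding c_def by linarith
    then show "max 0 t < (real_of_int (c k t) + 1) / real (Suc k)"
      by (subst pos_less_divide_eq) auto
    have "real_of_int (c k t) \<le> max 0 t * real (Suc k)"
      unfolding c_def by linarith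
    then have "real_of_int (c k t) / real (Suc k) \<le> max 0 t"
      by (subst pos_divide_le_eq) auto
    then show "(real_of_int (c k t) + 1) / real (Suc k) \<le> max 0 t + 1 / real (Suc k)"
      by (simp add: add_divide_distrib)
  qed
  have [measurable]: "c k \<in> measurable borel (count_space UNIV)" for k
    unfolding c_def[abs_def] by measurable
  have X': "(\<lambda>x. X (max 0 ((real_of_int i + 1) / real (Suc k))) (fst x)) \<in> borel_measurable (M \<Otimes>\<^sub>M borel)"
    for i k
    by (rule measurable_compose[OF measurable_fst X]) simp
  show ?thesis
  proof (rule borel_measurable_LIMSEQ_metric)
    fix k
    have "(\<lambda>x. X (max 0 ((real_of_int (c k (snd x)) + 1) / real (Suc k))) (fst x))
       \<in> borel_measurable (M \<Otimes>\<^sub>M borel)"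
      \<comment> \<open>For fixed \<open>k\<close> the grid index takes countably many values, so
        measurability at each single grid time is enough.\<close>
      by (rule measurable_compose_countable[OF X']) measurable
    then show "(\<lambda>(\<omega>, t). X (max 0 ((real_of_int (c k t) + 1) / real (Suc k))) \<omega>)
       \<in> borel_measurable (M \<Otimes>\<^sub>M borel)"
      by (simp add: case_prod_beta')
  next
    fix x :: "'w \<times> real" assume x: "x \<in> space (M \<Otimes>\<^sub>M borel)"
    obtain \<omega> t where [simp]: "x = (\<omega>, t)" and \<omega>: "\<omega> \<in> space M"
      using x by (cases x) (auto simp: space_pair_measure)
    have "(\<lambda>k. max 0 t + 1 / real (Suc k)) \<longlonglongrightarrow> max 0 t + 0"
      by (intro tendsto_add tendsto_const LIMSEQ_inverse_real_of_nat[unfolded inverse_eq_divide])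
    then have "(\<lambda>k. (real_of_int (c k t) + 1) / real (Suc k)) \<longlonglongrightarrow> max 0 t"
      unfolding add_0_right
      by (rule tendsto_sandwich[OF always_eventually[OF allI[OF less_imp_le[OF c(1)]]]
            always_eventually[OF allI[OF c(2)]] tendsto_const])
    then have "filterlim (\<lambda>k. (real_of_int (c k t) + 1) / real (Suc k)) (at_right (max 0 t)) sequentially"
      unfolding filterlim_at by (simp only: greaterThan_iff c(1) less_imp_neq[OF c(1), symmetric]) simp
    then have "(\<lambda>k. X ((real_of_int (c k t) + 1) / real (Suc k)) \<omega>) \<longlonglongrightarrow> X (max 0 t) \<omega>"
      using filterlim_compose[OF rc[OF \<omega>, of "max 0 t"]] by simp
    moreover have "max 0 ((real_of_int (c k t) + 1) / real (Suc k)) = (real_of_int (c k t) + 1) / real (Suc k)" for k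
      using c(1)[of t k] by linarith
    ultimately show "(\<lambda>k. case x of (\<omega>, t) \<Rightarrow> X (max 0 ((real_of_int (c k t) + 1) / real (Suc k))) \<omega>)
       \<longlonglongrightarrow> (case x of (\<omega>, t) \<Rightarrow> X (max 0 t) \<omega>)"
      by simp
  qed
qed

text \<open>Multiplied by \<open>lam\<close>, the integrand is the exponential density, which has
  total mass 1.\<close>

lemma nn_integral_exp_halfline_finite:
  assumes "lam > 0"
  shows "(\<integral>\<^sup>+t\<in>{0..}. ennreal (exp (- lam * t)) \<partial>lborel) < \<infinity>"
proof -
  interpret prob_space "density lborel (exponential_density lam)"
    by (rule prob_space_exponential_density[OF assms])
  have "1 = (\<integral>\<^sup>+t. ennreal (exponential_density lam t) \<partial>lborel)"
    using emeasure_space_1 by (simp add: emeasure_density)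
  also have "\<dots> = (\<integral>\<^sup>+t. ennreal lam * (ennreal (exp (- lam * t)) * indicator {0..} t) \<partial>lborel)"
    using assms
    by (intro nn_integral_cong)
       (auto simp: exponential_density_def indicator_def ennreal_mult' mult.commute)
  also have "\<dots> = ennreal lam * (\<integral>\<^sup>+t\<in>{0..}. ennreal (exp (- lam * t)) \<partial>lborel)"
    by (rule nn_integral_cmult) measurable
  finally show ?thesis
    using assms by (auto simp: top.not_eq_extremum[symmetric] ennreal_mult_top)
qed

context
  fixes Q :: "'w measure" and X :: "real \<Rightarrow> 'w \<Rightarrow> 'a::euclidean_space" and lam :: real
  assumes Q: "prob_space Q"
    and X: "\<And>t. t \<ge> 0 \<Longrightarrow> X t \<in> borel_measurable Q"
    and rc: "\<And>\<omega> t. \<omega> \<in> space Q \<Longrightarrow> t \<ge> 0 \<Longrightarrow> ((\<lambda>s. X s \<omega>) \<longlongrightarrow> X t \<omega>) (at_right t)"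
    and lam: "lam > 0"
begin

lemma path_pair_measurable: "(\<lambda>(\<omega>, t). X (max 0 t) \<omega>) \<in> borel_measurable (Q \<Otimes>\<^sub>M lborel)"
  using right_continuous_pair_measurable[of X Q, OF X rc]
  by (simp cong: measurable_cong_sets sets_pair_measure_cong)

text \<open>\<^const>\<open>measure_of\<close> returns the null measure on set functions that are not countably additive;
  here the joint measurability of the process rules this out.\<close>

lemma
  shows sets_resolvent_measure: "sets (resolvent_measure Q X lam) = sets borel"
    and emeasure_resolvent_measure: "\<And>C. C \<in> sets borel \<Longrightarrow> emeasure (resolvent_measure Q X lam) C =
      (\<integral>\<^sup>+\<omega>. (\<integral>\<^sup>+t\<in>{0..}. ennreal (exp (- lam * t)) * indicator C (X t \<omega>) \<partial>lborel) \<partial>Q)"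
proof -
  let ?d = "\<lambda>(\<omega>, t). ennreal (exp (- lam * t)) * indicator {0..} t"
  let ?Y = "\<lambda>(\<omega>, t). X (max 0 t) \<omega>"
  \<comment> \<open>The image, under the path map, of the product measure weighted by the discount
    factor. Being a measure by construction, it supplies the countable additivity; Tonelli's theorem
    identifies its values in \<open>eq\<close>.\<close>
  let ?N = "distr (density (Q \<Otimes>\<^sub>M lborel) ?d) borel ?Y"
  have [measurable]: "?Y \<in> borel_measurable (Q \<Otimes>\<^sub>M lborel)"
    by (rule path_pair_measurable)
  have [measurable]: "?d \<in> borel_measurable (Q \<Otimes>\<^sub>M lborel)"
    by measurable
  have eq: "emeasure ?N C =
      (\<integral>\<^sup>+\<omega>. (\<integral>\<^sup>+t\<in>{0..}. ennreal (exp (- lam * t)) * indicator C (X t \<omega>) \<partial>lborel) \<partial>Q)"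
    if C[measurable]: "C \<in> sets borel" for C
  proof -
    have "emeasure ?N C = (\<integral>\<^sup>+x. indicator C x \<partial>?N)"
      using C by (subst nn_integral_indicator) auto
    also have "\<dots> = (\<integral>\<^sup>+x. indicator C (?Y x) \<partial>density (Q \<Otimes>\<^sub>M lborel) ?d)"
      by (rule nn_integral_distr) measurable
    also have "\<dots> = (\<integral>\<^sup>+x. ?d x * indicator C (?Y x) \<partial>(Q \<Otimes>\<^sub>M lborel))"
      by (rule nn_integral_density) measurable
    also have "\<dots> = (\<integral>\<^sup>+\<omega>. (\<integral>\<^sup>+t. ?d (\<omega>, t) * indicator C (?Y (\<omega>, t)) \<partial>lborel) \<partial>Q)"
      by (rule lborel.nn_integral_fst[symmetric]) measurable
    also have "\<dots> = (\<integral>\<^sup>+\<omega>. (\<integral>\<^sup>+t\<in>{0..}. ennreal (exp (- lam * t)) * indicator C (X t \<omega>) \<partial>lborel) \<partial>Q)"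
      by (intro nn_integral_cong) (auto simp: indicator_def)
    finally show ?thesis .
  qed
  have sigma: "sigma_sets UNIV (sets borel) = (sets borel :: 'a set set)"
    using sets.sigma_sets_eq[of borel] by simp
  \<comment> \<open>\<open>measure_of\<close> depends on the set function only through its values on
    the generated sigma-algebra, where \<open>eq\<close> applies.\<close>
  have "resolvent_measure Q X lam = measure_of UNIV (sets borel) (emeasure ?N)"
    unfolding resolvent_measure_def by (rule measure_of_eq) (simp_all only: eq sigma subset_UNIV Pow_UNIV)
  also have "\<dots> = ?N"
    using measure_of_of_measure[of ?N] by simp
  finally have N: "resolvent_measure Q X lam = ?N" .
  show "sets (resolvent_measure Q X lam) = sets borel"
    unfolding N by simp
  show "\<And>C. C \<in> sets borel \<Longrightarrow> emeasure (resolvent_measure Q X lam) C =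
      (\<integral>\<^sup>+\<omega>. (\<integral>\<^sup>+t\<in>{0..}. ennreal (exp (- lam * t)) * indicator C (X t \<omega>) \<partial>lborel) \<partial>Q)"
    unfolding N by (rule eq)
qed

lemma finite_resolvent_measure: "finite_measure (resolvent_measure Q X lam)"
proof
  interpret prob_space Q by (rule Q)
  have "emeasure (resolvent_measure Q X lam) UNIV < \<infinity>"
    using nn_integral_exp_halfline_finite[OF lam]
    by (simp add: emeasure_resolvent_measure emeasure_space_1)
  then show "emeasure (resolvent_measure Q X lam) (space (resolvent_measure Q X lam)) \<noteq> \<infinity>"
    using sets_eq_imp_space_eq[OF sets_resolvent_measure] by simp
qed

text \<open>Zero resolvent mass means that almost every path spends zero Lebesgue time in
  \<open>B\<close>. A right-continuous path that visits an open set stays there on an interval to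
  the right, hence for positive time. One exceptional set of paths therefore serves all times at
  once.\<close>

lemma AE_avoids_null_open_set:
  assumes B: "open B" and null: "emeasure (resolvent_measure Q X lam) B = 0"
  shows "AE \<omega> in Q. \<forall>t\<ge>0. X t \<omega> \<notin> B"
proof -
  have [measurable]: "B \<in> sets borel" using B by simp
  have Y[measurable]: "(\<lambda>(\<omega>, t). X (max 0 t) \<omega>) \<in> borel_measurable (Q \<Otimes>\<^sub>M lborel)"
    by (rule path_pair_measurable)
  \<comment> \<open>Replacing \<open>X t\<close> by \<open>X (max 0 t)\<close> changes nothing on
    the half-line and makes the integrand jointly measurable.\<close>
  have int_eq: "(\<integral>\<^sup>+t\<in>{0..}. ennreal (exp (- lam * t)) * indicator B (X t \<omega>) \<partial>lborel) =
      (\<integral>\<^sup>+t. ennreal (exp (- lam * t)) * indicator {0..} t *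
         indicator B ((\<lambda>(\<omega>, t). X (max 0 t) \<omega>) (\<omega>, t)) \<partial>lborel)" for \<omega>
    by (intro nn_integral_cong) (auto simp: indicator_def)
  have "AE \<omega> in Q. (\<integral>\<^sup>+t. ennreal (exp (- lam * t)) * indicator {0..} t *
         indicator B ((\<lambda>(\<omega>, t). X (max 0 t) \<omega>) (\<omega>, t)) \<partial>lborel) = 0"
    using null unfolding emeasure_resolvent_measure[OF \<open>B \<in> sets borel\<close>] int_eq
    by (subst (asm) nn_integral_0_iff_AE) measurable
  then show ?thesis
  proof (rule AE_mp, intro AE_I2 impI allI notI)
    fix \<omega> t
    assume \<omega>: "\<omega> \<in> space Q" and t: "0 \<le> t" and inB: "X t \<omega> \<in> B"
      and zero: "(\<integral>\<^sup>+t. ennreal (exp (- lam * t)) * indicator {0..} t *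
         indicator B ((\<lambda>(\<omega>, t). X (max 0 t) \<omega>) (\<omega>, t)) \<partial>lborel) = 0"
    have "(\<lambda>t. (\<lambda>(\<omega>, t). X (max 0 t) \<omega>) (\<omega>, t)) \<in> borel_measurable lborel"
      by (rule measurable_compose[OF measurable_Pair1'[OF \<omega>] Y])
    then have [measurable]: "(\<lambda>t. X (max 0 t) \<omega>) \<in> borel_measurable borel"
      by simp
    have *: "AE s in lborel. s \<ge> 0 \<longrightarrow> X s \<omega> \<notin> B"
      using zero by (subst (asm) nn_integral_0_iff_AE) (auto simp: indicator_def)
    have "eventually (\<lambda>s. X s \<omega> \<in> B) (at_right t)"
      using topological_tendstoD[OF rc[OF \<omega> t] B inB] .
    then obtain b where b: "b > t" "\<And>s. t < s \<Longrightarrow> s < b \<Longrightarrow> X s \<omega> \<in> B"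
      unfolding eventually_at_right_field by auto
    have "AE s in lborel. s \<notin> {t<..<b}"
      using * by (rule AE_mp) (use b t in auto)
    then have "{t<..<b} = {}"
      by (intro open_AE_lborel_empty) auto
    then show False using b by simp
  qed
qed

end

section \<open>The operator outside the support of a function\<close>

lemma integrable_indicator_cball:
  "integrable lborel (\<lambda>h. c * indicator (cball a r) h :: real)"
  using emeasure_lborel_cball_finite[of a r]
  by (intro integrable_mult_right integrable_real_indicator) auto

text \<open>Both the value and the gradient of \<open>f\<close> vanish at \<open>x\<close>, so no
  compensating term is left.\<close>

lemma jump_operator_off_support:
  assumes "open U" "x \<in> U" "\<And>y. y \<in> U \<Longrightarrow> f y = 0"
  shows "jump_operator n f x = (LINT h:-{0}|lborel. f (x + h) * n x h)"
proof -
  have "grad f x = 0"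
    using frechet_derivative_locally_zero[of U x f, OF assms] by (simp add: grad_def partial_deriv_def)
  moreover have "f x = 0"
    using assms by simp
  ultimately show ?thesis
    by (simp add: jump_operator_def)
qed

context
  fixes n :: "'a::euclidean_space \<Rightarrow> 'a \<Rightarrow> real" and \<kappa> \<beta> :: real
    and f :: "'a \<Rightarrow> real" and z :: 'a and \<rho> K :: real
  assumes n_measurable: "\<And>x. set_borel_measurable lborel (-{0}) (n x)"
    and n_pos: "\<And>x h. h \<noteq> 0 \<Longrightarrow> 0 < n x h"
    and n_upper: "\<And>x h. h \<noteq> 0 \<Longrightarrow> n x h \<le> \<kappa> * norm h powr (- \<beta>)"
    and n_cont: "\<And>h y. h \<noteq> 0 \<Longrightarrow> isCont (\<lambda>x. n x h) y"
    and \<kappa>: "0 \<le> \<kappa>" and \<beta>: "0 \<le> \<beta>"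
    and f_cont: "continuous_on UNIV f"
    and f_nonneg: "\<And>x. 0 \<le> f x" and f_le: "\<And>x. f x \<le> K" and f_z: "0 < f z"
    and f_support: "\<And>x. f x \<noteq> 0 \<Longrightarrow> dist x z \<le> \<rho>"
    and \<rho>: "0 < \<rho>"
begin

lemma jump_integrand_measurable:
  "(\<lambda>h. indicator (-{0}) h * (f (x + h) * n x h)) \<in> borel_measurable lborel"
proof -
  have 1: "(\<lambda>h. indicator (-{0}) h *\<^sub>R n x h) \<in> borel_measurable lborel"
    using n_measurable unfolding set_borel_measurable_def .
  have "continuous_on UNIV (\<lambda>h. f (x + h))"
    by (auto intro!: continuous_intros continuous_on_compose2[OF f_cont])
  then have 2: "(\<lambda>h. f (x + h)) \<in> borel_measurable lborel"
    by (simp add: borel_measurable_continuous_onI)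
  have "(\<lambda>h. f (x + h) * (indicator (-{0}) h *\<^sub>R n x h)) \<in> borel_measurable lborel"
    by (rule borel_measurable_times[OF 2 1])
  then show ?thesis
    by (simp add: mult.left_commute)
qed

lemma jump_integrand_nonneg: "0 \<le> indicator (-{0}) h * (f (x + h) * n x h)"
  using f_nonneg[of "x + h"] n_pos[of h x] by (cases "h = 0") auto

text \<open>From distance at least \<open>2 * \<rho>\<close>, a jump into the support of
  \<open>f\<close> has length at least \<rho>. It stays away from the singularity of the kernel at
  0, where \<open>n_upper\<close> gives no uniform bound.\<close>

lemma jump_integrand_le:
  assumes x: "2 * \<rho> \<le> dist x z"
  shows "indicator (-{0}) h * (f (x + h) * n x h) \<le>
    K * (\<kappa> * \<rho> powr (- \<beta>)) * indicator (cball (z - x) \<rho>) h"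
proof (cases "h \<noteq> 0 \<and> f (x + h) \<noteq> 0")
  case True
  then have d: "dist (x + h) z \<le> \<rho>"
    using f_support by blast
  then have h: "h \<in> cball (z - x) \<rho>"
    by (simp add: dist_norm norm_minus_commute algebra_simps)
  have "dist x z \<le> norm h + dist (x + h) z"
    using dist_triangle[of x z "x + h"] by (simp add: dist_norm)
  then have "\<rho> \<le> norm h"
    using d x by linarith
  then have "norm h powr (- \<beta>) \<le> \<rho> powr (- \<beta>)"
    using \<rho> \<beta> by (intro powr_mono2') auto
  then have "n x h \<le> \<kappa> * \<rho> powr (- \<beta>)"
    using n_upper[of h x] True \<kappa> by (meson mult_left_mono order_trans)
  then have "f (x + h) * n x h \<le> K * (\<kappa> * \<rho> powr (- \<beta>))"
    using True f_nonneg f_le n_pos[of h x]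
    by (intro mult_mono) (auto intro: order_trans[OF f_nonneg f_le])
  then show ?thesis
    using True h by simp
next
  case False
  have "0 \<le> K"
    using f_nonneg f_le order_trans by blast
  then show ?thesis
    using False \<kappa> by (auto simp: indicator_def)
qed

lemma jump_integrand_integrable:
  assumes x: "2 * \<rho> \<le> dist x z"
  shows "integrable lborel (\<lambda>h. indicator (-{0}) h * (f (x + h) * n x h))"
proof (rule Bochner_Integration.integrable_bound[OF _ jump_integrand_measurable])
  show "integrable lborel (\<lambda>h. K * (\<kappa> * \<rho> powr (- \<beta>)) * indicator (cball (z - x) \<rho>) h)"
    by (rule integrable_indicator_cball)
  show "AE h in lborel. norm (indicator (-{0}) h * (f (x + h) * n x h))
      \<le> norm (K * (\<kappa> * \<rho> powr (- \<beta>)) * indicator (cball (z - x) \<rho>) h)"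
  proof (rule AE_I2)
    fix h
    show "norm (indicator (-{0}) h * (f (x + h) * n x h))
      \<le> norm (K * (\<kappa> * \<rho> powr (- \<beta>)) * indicator (cball (z - x) \<rho>) h)"
      using jump_integrand_le[OF x, of h] jump_integrand_nonneg[of h x]
      unfolding real_norm_def by linarith
  qed
qed

lemma jump_operator_eq:
  assumes x: "2 * \<rho> \<le> dist x z"
  shows "jump_operator n f x = (LINT h|lborel. indicator (-{0}) h * (f (x + h) * n x h))"
proof -
  have "jump_operator n f x = (LINT h:-{0}|lborel. f (x + h) * n x h)"
  proof (rule jump_operator_off_support)
    show "open (- cball z \<rho>)" by (simp add: open_Compl)
    show "x \<in> - cball z \<rho>" using x \<rho> by (simp add: dist_commute)
    show "f y = 0" if "y \<in> - cball z \<rho>" for y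
      using f_support[of y] that by (auto simp: dist_commute)
  qed
  then show ?thesis
    by (simp add: set_lebesgue_integral_def)
qed

text \<open>The nonzero jumps to points where \<open>f\<close> is positive form an open set on which
  the integrand is positive. A zero integral would make that set null, hence empty.\<close>

lemma jump_operator_pos:
  assumes x: "2 * \<rho> \<le> dist x z"
  shows "0 < jump_operator n f x"
proof (rule ccontr)
  assume "\<not> 0 < jump_operator n f x"
  moreover have "0 \<le> jump_operator n f x"
    unfolding jump_operator_eq[OF x]
    by (rule Bochner_Integration.integral_nonneg) (rule jump_integrand_nonneg)
  ultimately have "(LINT h|lborel. indicator (-{0}) h * (f (x + h) * n x h)) = 0"
    unfolding jump_operator_eq[OF x] by linarith
  then have "AE h in lborel. indicator (-{0}) h * (f (x + h) * n x h) = 0"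
    using integral_nonneg_eq_0_iff_AE[OF jump_integrand_integrable[OF x]] jump_integrand_nonneg
    by simp
  then have "AE h in lborel. h \<notin> {h. 0 < f (x + h)} - {0}"
  proof (rule AE_mp, intro AE_I2 impI notI)
    fix h
    assume 0: "indicator (-{0}) h * (f (x + h) * n x h) = 0" and h: "h \<in> {h. 0 < f (x + h)} - {0}"
    then have "0 < f (x + h) * n x h"
      using n_pos[of h x] by (intro mult_pos_pos) auto
    then show False
      using 0 h by simp
  qed
  moreover have "open ({h. 0 < f (x + h)} - {0})"
    by (intro open_Diff open_Collect_less continuous_intros continuous_on_compose2[OF f_cont]) auto
  ultimately have "{h. 0 < f (x + h)} - {0} = {}"
    by (rule open_AE_lborel_empty[rotated])
  \<comment> \<open>The jump straight to the centre \<open>z\<close>; it is nonzero because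
    \<open>x\<close> is at distance at least \<open>2 * \<rho>\<close>.\<close>
  moreover have "z - x \<in> {h. 0 < f (x + h)} - {0}"
    using x \<rho> f_z by auto
  ultimately show False by blast
qed

text \<open>The bound is uniform in \<open>x\<close>, which makes the operator integrable in time
  along a path.\<close>

lemma jump_operator_le:
  assumes x: "2 * \<rho> \<le> dist x z"
  shows "jump_operator n f x \<le> K * (\<kappa> * \<rho> powr (- \<beta>)) * (unit_ball_vol DIM('a) * \<rho> ^ DIM('a))"
proof -
  have "jump_operator n f x \<le> (LINT h|lborel. K * (\<kappa> * \<rho> powr (- \<beta>)) * indicator (cball (z - x) \<rho>) h)"
    unfolding jump_operator_eq[OF x]
    by (intro integral_mono jump_integrand_integrable x jump_integrand_le integrable_indicator_cball)
  also have "\<dots> = K * (\<kappa> * \<rho> powr (- \<beta>)) * measure lborel (cball (z - x) \<rho>)"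
    by simp
  also have "measure lborel (cball (z - x) \<rho>) = unit_ball_vol DIM('a) * \<rho> ^ DIM('a)"
    using content_cball[of \<rho> "z - x"] \<rho> by simp
  finally show ?thesis .
qed

text \<open>Dominated convergence applies because \<open>f\<close> and the kernel are continuous in
  \<open>x\<close> for each fixed jump. Continuity makes the operator right-continuous, hence
  measurable, along paths.\<close>

lemma continuous_on_jump_operator: "continuous_on {x. 2 * \<rho> \<le> dist x z} (jump_operator n f)"
  unfolding continuous_on_sequentially
proof (intro ballI allI impI)
  fix u x
  assume x: "x \<in> {x. 2 * \<rho> \<le> dist x z}" and u: "(\<forall>k. u k \<in> {x. 2 * \<rho> \<le> dist x z}) \<and> u \<longlonglongrightarrow> x"
  then have ux: "2 * \<rho> \<le> dist (u k) z" for k by simp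
  have "bounded (range u)"
    using u convergent_imp_bounded by blast
  then obtain B where B: "\<And>k. norm (u k) \<le> B"
    unfolding bounded_iff by auto
  have K0: "0 \<le> K * (\<kappa> * \<rho> powr (- \<beta>))"
    using \<kappa> order_trans[OF f_nonneg f_le] by simp
  have "(\<lambda>k. LINT h|lborel. indicator (-{0}) h * (f (u k + h) * n (u k) h))
      \<longlonglongrightarrow> (LINT h|lborel. indicator (-{0}) h * (f (x + h) * n x h))"
  proof (rule integral_dominated_convergence[OF jump_integrand_measurable jump_integrand_measurable])
    \<comment> \<open>The majorant of \<open>jump_integrand_le\<close> sits on the ball around
      \<open>z - u k\<close>, which moves with \<open>k\<close>. The bound \<open>B\<close> on the
      sequence gives one fixed ball containing all of these.\<close>
    show "integrable lborel
        (\<lambda>h. K * (\<kappa> * \<rho> powr (- \<beta>)) * indicator (cball 0 (norm z + B + \<rho>)) h :: real)"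
      by (rule integrable_indicator_cball)
    show "AE h in lborel. (\<lambda>k. indicator (-{0}) h * (f (u k + h) * n (u k) h))
        \<longlonglongrightarrow> indicator (-{0}) h * (f (x + h) * n x h)"
    proof (rule AE_I2)
      fix h
      show "(\<lambda>k. indicator (-{0}) h * (f (u k + h) * n (u k) h))
        \<longlonglongrightarrow> indicator (-{0}) h * (f (x + h) * n x h)"
      proof (cases "h = 0")
        case False
        have "isCont f (x + h)"
          using f_cont by (simp add: continuous_on_eq_continuous_at)
        then have "(\<lambda>k. f (u k + h)) \<longlonglongrightarrow> f (x + h)"
          using u by (intro isCont_tendsto_compose[of _ f] tendsto_intros) auto
        moreover have "(\<lambda>k. n (u k) h) \<longlonglongrightarrow> n x h"
          using u isCont_tendsto_compose[OF n_cont[OF False]] by blast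
        ultimately show ?thesis
          by (intro tendsto_mult tendsto_const)
      qed simp
    qed
    fix k
    show "AE h in lborel. norm (indicator (-{0}) h * (f (u k + h) * n (u k) h))
        \<le> K * (\<kappa> * \<rho> powr (- \<beta>)) * indicator (cball 0 (norm z + B + \<rho>)) h"
    proof (rule AE_I2)
      fix h :: 'a
      have "norm h \<le> norm z + B + \<rho>" if "h \<in> cball (z - u k) \<rho>"
      proof -
        have "norm h \<le> norm (z - u k) + norm (h - (z - u k))"
          using norm_triangle_ineq[of "z - u k" "h - (z - u k)"] by simp
        also have "norm (h - (z - u k)) \<le> \<rho>"
          using that by (simp add: dist_norm norm_minus_commute)
        finally show ?thesis
          using norm_triangle_ineq4[of z "u k"] B[of k] by linarith
      qed
      then have "indicator (cball (z - u k) \<rho>) h \<le> (indicator (cball 0 (norm z + B + \<rho>)) h :: real)"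
        by (auto simp: indicator_def)
      then have "K * (\<kappa> * \<rho> powr (- \<beta>)) * indicator (cball (z - u k) \<rho>) h
        \<le> K * (\<kappa> * \<rho> powr (- \<beta>)) * (indicator (cball 0 (norm z + B + \<rho>)) h :: real)"
        by (intro mult_left_mono K0)
      then show "norm (indicator (-{0}) h * (f (u k + h) * n (u k) h))
        \<le> K * (\<kappa> * \<rho> powr (- \<beta>)) * indicator (cball 0 (norm z + B + \<rho>)) h"
        using jump_integrand_le[OF ux, of h k] jump_integrand_nonneg[of h "u k"]
        unfolding real_norm_def by linarith
    qed
  qed
  then show "(jump_operator n f \<circ> u) \<longlonglongrightarrow> jump_operator n f x"
    using x by (simp add: o_def jump_operator_eq[OF ux] jump_operator_eq)
qed

text \<open>In time the integrand is positive, bounded and measurable. Its integrability has to be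
  established first, since the Bochner integral of a non-integrable function is 0 by
  convention.\<close>

lemma jump_operator_path_integral_pos:
  fixes p :: "real \<Rightarrow> 'a"
  assumes rc: "\<And>t. t \<ge> 0 \<Longrightarrow> (p \<longlongrightarrow> p t) (at_right t)"
    and avoid: "\<And>t. t \<ge> 0 \<Longrightarrow> 2 * \<rho> \<le> dist (p t) z"
  shows "0 < (LINT s:{0..1}|lborel. jump_operator n f (p s))"
proof -
  define q where "q s = indicator {0..1} s * jump_operator n f (p (max 0 s))" for s :: real
  define C where "C = K * (\<kappa> * \<rho> powr (- \<beta>)) * (unit_ball_vol DIM('a) * \<rho> ^ DIM('a))"
  have 1: "((\<lambda>s. jump_operator n f (p s)) \<longlongrightarrow> jump_operator n f (p t)) (at_right t)" if "t \<ge> 0" for t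
  proof (rule continuous_on_tendsto_compose[OF continuous_on_jump_operator rc[OF that]])
    show "p t \<in> {x. 2 * \<rho> \<le> dist x z}"
      using avoid that by simp
    show "eventually (\<lambda>s. p s \<in> {x. 2 * \<rho> \<le> dist x z}) (at_right t)"
      using avoid that by (auto simp: eventually_at_filter intro!: always_eventually)
  qed
  have "(\<lambda>(\<omega>, t). jump_operator n f (p (max 0 t))) \<in> borel_measurable (count_space (UNIV :: unit set) \<Otimes>\<^sub>M borel)"
    \<comment> \<open>The single path is treated as a process on a one-point space, so that the
      joint measurability lemma covers it.\<close>
    using right_continuous_pair_measurable[of "\<lambda>t _. jump_operator n f (p t)" "count_space UNIV"] 1
    by simp
  from measurable_compose[OF measurable_Pair1'[of "()"] this]
  have "(\<lambda>t. jump_operator n f (p (max 0 t))) \<in> borel_measurable borel"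
    by simp
  then have [measurable]: "q \<in> borel_measurable borel"
    unfolding q_def[abs_def] by measurable
  have av: "2 * \<rho> \<le> dist (p (max 0 s)) z" for s
    using avoid by simp
  have q0: "q s \<ge> 0" for s
    unfolding q_def using jump_operator_pos[OF av, of s] by (auto simp: indicator_def)
  have "integrable lborel q"
  proof (rule Bochner_Integration.integrable_bound)
    show "integrable lborel (\<lambda>s. C * indicator {0..1::real} s)"
      by (intro integrable_mult_right integrable_real_indicator) auto
    show "AE s in lborel. norm (q s) \<le> norm (C * indicator {0..1::real} s)"
    proof (rule AE_I2)
      fix s
      show "norm (q s) \<le> norm (C * indicator {0..1::real} s)"
        using jump_operator_le[OF av, of s] jump_operator_pos[OF av, of s]
        by (auto simp: q_def C_def indicator_def)
    qed
  qed measurable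
  note int = this
  have "(LINT s|lborel. q s) \<noteq> 0"
  proof
    assume "(LINT s|lborel. q s) = 0"
    then have "AE s in lborel. q s = 0"
      using integral_nonneg_eq_0_iff_AE[OF int] q0 by simp
    then have "AE s in lborel. s \<notin> {0<..<1::real}"
    proof (rule AE_mp, intro AE_I2 impI notI)
      fix s :: real
      assume "q s = 0" "s \<in> {0<..<1}"
      then show False
        using jump_operator_pos[OF av, of s] by (simp add: q_def)
    qed
    then have "{0<..<1::real} = {}"
      by (intro open_AE_lborel_empty) auto
    then show False by simp
  qed
  then have "(LINT s|lborel. q s) > 0"
    using Bochner_Integration.integral_nonneg[of lborel q, OF q0] by linarith
  also have "(LINT s|lborel. q s) = (LINT s:{0..1}|lborel. jump_operator n f (p s))"
    unfolding set_lebesgue_integral_def q_def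
    by (intro Bochner_Integration.integral_cong) (auto simp: indicator_def)
  finally show ?thesis .
qed

end

section \<open>Full support\<close>

text \<open>Conditioning on \<open>F 0\<close> preserves the integral and turns \<open>Z t\<close>
  into \<open>Z 0\<close> almost surely.\<close>

lemma martingale_integral_eq_initial:
  assumes "martingale Q F Z" "prob_space Q" "subalgebra Q (F 0)" "t \<ge> 0"
  shows "(LINT \<omega>|Q. Z t \<omega>) = (LINT \<omega>|Q. Z 0 \<omega>)"
proof -
  interpret prob_space Q by fact
  interpret finite_measure_subalgebra Q "F 0"
    by unfold_locales (rule assms(3))
  have int: "integrable Q (Z s)" and meas: "Z s \<in> borel_measurable Q" if "s \<ge> 0" for s
    using assms(1) that by (auto simp: martingale_def)
  have "AE \<omega> in Q. real_cond_exp Q (F 0) (Z t) \<omega> = Z 0 \<omega>"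
    using assms(1,4) unfolding martingale_def by (metis ennreal_0 order_refl)
  then have "(LINT \<omega>|Q. real_cond_exp Q (F 0) (Z t) \<omega>) = (LINT \<omega>|Q. Z 0 \<omega>)"
    by (intro integral_cong_AE borel_measurable_cond_exp2 meas) auto
  then show ?thesis
    using real_cond_exp_int(2)[OF int[OF assms(4)]] by simp
qed

text \<open>The test function is the mollifier itself, translated to \<open>z\<close> and rescaled.
  Avoidance of the ball would make its martingale almost surely negative at time 1, although its
  mean is still the initial value 0.\<close>

lemma not_AE_avoids_ball:
  fixes n :: "'a::euclidean_space \<Rightarrow> 'a \<Rightarrow> real" and X :: "real \<Rightarrow> 'w \<Rightarrow> 'a" and \<phi> :: "'a \<Rightarrow> real"
  assumes n_measurable: "\<And>x. set_borel_measurable lborel (-{0}) (n x)"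
    and n_pos: "\<And>x h. h \<noteq> 0 \<Longrightarrow> 0 < n x h"
    and n_upper: "\<And>x h. h \<noteq> 0 \<Longrightarrow> n x h \<le> \<kappa> * norm h powr (- \<beta>)"
    and n_cont: "\<And>h y. h \<noteq> 0 \<Longrightarrow> isCont (\<lambda>x. n x h) y"
    and \<kappa>: "0 \<le> \<kappa>" and \<beta>: "0 \<le> \<beta>"
    and \<phi>: "is_mollifier \<phi>"
    and Q: "solves_martingale_problem n F X Q x"
    and F: "subalgebra Q (F 0)"
    and rc: "\<And>\<omega> t. \<omega> \<in> space Q \<Longrightarrow> t \<ge> 0 \<Longrightarrow> ((\<lambda>s. X s \<omega>) \<longlongrightarrow> X t \<omega>) (at_right t)"
    and r: "r > 0"
  shows "\<not> (AE \<omega> in Q. \<forall>t\<ge>0. X t \<omega> \<notin> ball z r)"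
proof
  assume avoid: "AE \<omega> in Q. \<forall>t\<ge>0. X t \<omega> \<notin> ball z r"
  interpret prob_space Q
    using Q unfolding solves_martingale_problem_def by blast
  obtain R K r' where \<phi>': "R > 0" "\<And>x. \<phi> x \<noteq> 0 \<Longrightarrow> norm x \<le> R" "\<And>x. \<phi> x \<le> K"
    "continuous_on UNIV \<phi>" "\<And>x. \<phi> x \<ge> 0" "r' > 0" "\<And>x. norm x < r' \<Longrightarrow> \<phi> x > 0"
    using mollifier_properties[OF \<phi>] by metis
  \<comment> \<open>With \<open>2 * \<rho> = r\<close>, avoiding the ball is exactly the distance
    condition required of the path.\<close>
  define \<rho> where "\<rho> = r / 2"
  have \<rho>: "\<rho> > 0" using r by (simp add: \<rho>_def)
  \<comment> \<open>The factor \<open>R / \<rho>\<close> shrinks the support radius from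
    \<open>R\<close> to \<rho>; the prefactor 1 gives \<open>f\<close> the shape expected by
    \<open>C_class_affine\<close>.\<close>
  define f where "f y = 1 * \<phi> ((R / \<rho>) *\<^sub>R (y - z))" for y
  have f_support: "dist y z \<le> \<rho>" if "f y \<noteq> 0" for y
  proof -
    have "norm ((R / \<rho>) *\<^sub>R (y - z)) \<le> R"
      using \<phi>'(2)[of "(R / \<rho>) *\<^sub>R (y - z)"] that by (simp add: f_def)
    moreover have "norm ((R / \<rho>) *\<^sub>R (y - z)) = R / \<rho> * dist y z"
      using \<phi>'(1) \<rho> by (simp add: dist_norm)
    ultimately have "R / \<rho> * dist y z \<le> R / \<rho> * \<rho>"
      using \<rho> by simp
    then show ?thesis
      using \<phi>'(1) \<rho> by (subst (asm) mult_le_cancel_left_pos) auto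
  qed
  have "C_class 2 \<phi>"
    using \<phi> unfolding is_mollifier_def by (elim conjE) (erule spec)
  then have C: "C_class 2 f"
    unfolding f_def by (rule C_class_affine)
  then have f_cont: "continuous_on UNIV f"
    by (rule C_class_continuous)
  have "C2_bounded f"
    by (rule C2_bounded_compact_support[OF C compact_cball[of z \<rho>]])
       (use f_support in \<open>auto simp: dist_commute\<close>)
  then have mart: "martingale Q F (\<lambda>t \<omega>. f (X t \<omega>) - f (X 0 \<omega>)
                      - (LINT s:{0..t}|lborel. jump_operator n f (X s \<omega>)))" (is "martingale Q F ?Z")
    using Q unfolding solves_martingale_problem_def by blast
  \<comment> \<open>The time integral runs over the Lebesgue null set \<open>{0..0}\<close>.\<close>
  have Z0: "?Z 0 \<omega> = 0" for \<omega>
  proof -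
    have "(LINT s:{0..0::real}|lborel. jump_operator n f (X s \<omega>)) = 0"
      unfolding set_lebesgue_integral_def
      by (rule integral_eq_zero_AE, rule AE_mp[OF AE_lborel_singleton[of 0]])
         (auto simp: indicator_def intro!: AE_I2)
    then show ?thesis by simp
  qed
  have int: "integrable Q (?Z 1)"
    using mart unfolding martingale_def by simp
  have "(LINT \<omega>|Q. ?Z 1 \<omega>) = 0"
    using martingale_integral_eq_initial[OF mart prob_space_axioms F, of 1] Z0 by simp
  have neg: "AE \<omega> in Q. ?Z 1 \<omega> < 0"
    using avoid
  proof (rule AE_mp, intro AE_I2 impI)
    fix \<omega> assume \<omega>: "\<omega> \<in> space Q" and av: "\<forall>t\<ge>0. X t \<omega> \<notin> ball z r"
    have far: "2 * \<rho> \<le> dist (X t \<omega>) z" if "t \<ge> 0" for t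
      using av that by (auto simp: \<rho>_def dist_commute not_less)
    then have "f (X t \<omega>) = 0" if "t \<ge> 0" for t
      using f_support[of "X t \<omega>"] that \<rho> by fastforce
    moreover have "0 < (LINT s:{0..1}|lborel. jump_operator n f (X s \<omega>))"
    proof (rule jump_operator_path_integral_pos[of n \<kappa> \<beta> f K z \<rho>])
      show "0 < f z" "\<And>y. 0 \<le> f y" "\<And>y. f y \<le> K"
        using \<phi>'(3,5,6,7) by (auto simp: f_def)
    qed (fact n_measurable n_pos n_upper n_cont \<kappa> \<beta> f_cont f_support \<rho> rc[OF \<omega>] far)+
    ultimately show "?Z 1 \<omega> < 0" by simp
  qed
  \<comment> \<open>A nonnegative integrable function of mean zero vanishes almost surely. Together
    with \<open>neg\<close> this is impossible in a probability space.\<close>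
  have "AE \<omega> in Q. - ?Z 1 \<omega> = 0"
  proof (subst integral_nonneg_eq_0_iff_AE[symmetric])
    show "(LINT \<omega>|Q. - ?Z 1 \<omega>) = 0"
      using \<open>(LINT \<omega>|Q. ?Z 1 \<omega>) = 0\<close> by (subst Bochner_Integration.integral_minus) (simp only: neg_equal_0_iff_equal)
    show "AE \<omega> in Q. 0 \<le> - ?Z 1 \<omega>"
      using neg by (rule AE_mp) (intro AE_I2 impI, linarith)
  qed (use int in \<open>rule integrable_minus\<close>)
  with neg have "AE \<omega> in Q. False"
    by eventually_elim linarith
  then show False
    by simp
qed

theorem theorem5p6:
  fixes n :: "'a::euclidean_space \<Rightarrow> 'a \<Rightarrow> real"
    and \<kappa> \<alpha> lam :: real
    and M :: "'w measure" and F :: "ennreal \<Rightarrow> 'w measure"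
    and P :: "'a \<Rightarrow> 'w measure" and X :: "real \<Rightarrow> 'w \<Rightarrow> 'a"
    and \<phi> :: "'a \<Rightarrow> real" and x0 h :: 'a
  assumes n_measurable: "\<And>x. set_borel_measurable lborel (-{0}) (n x)"
    and n_symmetric: "\<And>x h. h \<noteq> 0 \<Longrightarrow> n x (- h) = n x h"
    and kappa: "0 < \<kappa>" "\<kappa> < 1"
    and alpha: "0 < \<alpha>" "\<alpha> < 2"
    and n_lower: "\<And>x h. h \<noteq> 0 \<Longrightarrow> \<kappa> * norm h powr (- real DIM('a) - \<alpha>) \<le> n x h"
    and n_upper: "\<And>x h. h \<noteq> 0 \<Longrightarrow> n x h \<le> inverse \<kappa> * norm h powr (- real DIM('a) - \<alpha>)"
    and n_continuous: "\<exists>\<eta>>0. weighted_kernel_continuous \<eta> n"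
    and strong_Markov: "strong_Markov_process M F P X"
    and martingale_problem: "\<And>x. solves_martingale_problem n F X (P x) x"
    and mollifier: "is_mollifier \<phi>"
    and lambda: "lam > 0"
    and h: "h \<noteq> 0"
  shows "AE x in lborel.
           ((\<lambda>\<epsilon>. mollified_kernel \<phi> (resolvent_measure (P x0) X lam) n \<epsilon> x h) \<longlongrightarrow> n x h) (at_right 0)"
proof -
  define \<mu> where "\<mu> = resolvent_measure (P x0) X lam"
  define \<beta> where "\<beta> = real DIM('a) + \<alpha>"
  \<comment> \<open>Strict positivity comes from the lower bound; it lets the process jump from
    anywhere into any ball.\<close>
  have n_pos: "0 < n x h" if "h \<noteq> 0" for x h
    using n_lower[OF that, of x] kappa that by (meson less_le_trans mult_pos_pos powr_gt_zero norm_eq_zero)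
  have n_upper': "n x h \<le> inverse \<kappa> * norm h powr (- \<beta>)" if "h \<noteq> 0" for x h
    using n_upper[OF that, of x] by (simp add: \<beta>_def)
  have n_cont: "isCont (\<lambda>x. n x h) y" if "h \<noteq> 0" for h y
    using n_continuous weighted_kernel_continuous_isCont that by blast
  have Q: "prob_space (P x0)" and sets_Q: "sets (P x0) = sets M"
    using strong_Markov unfolding strong_Markov_process_def by blast+
  have space_Q: "space (P x0) = space M"
    using sets_Q by (rule sets_eq_imp_space_eq)
  have sub: "subalgebra M (F t)" for t
    using strong_Markov unfolding strong_Markov_process_def by blast
  then have F0: "subalgebra (P x0) (F 0)"
    using sets_Q space_Q unfolding subalgebra_def by auto
  have X: "X t \<in> borel_measurable (P x0)" if "t \<ge> 0" for t
  proof -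
    have "X t \<in> borel_measurable (F (ennreal t))"
      using strong_Markov that unfolding strong_Markov_process_def by blast
    then have "X t \<in> borel_measurable M"
      by (rule measurable_from_subalg[OF sub])
    then show ?thesis
      using sets_Q by (simp cong: measurable_cong_sets)
  qed
  have "\<forall>\<omega>\<in>space M. rcll (\<lambda>t. X t \<omega>)"
    using strong_Markov unfolding strong_Markov_process_def by (elim conjE) assumption
  then have rc: "((\<lambda>s. X s \<omega>) \<longlongrightarrow> X t \<omega>) (at_right t)" if "\<omega> \<in> space (P x0)" "t \<ge> 0" for \<omega> t
    using that space_Q unfolding rcll_def by auto
  have sets_\<mu>: "sets \<mu> = sets borel"
    unfolding \<mu>_def by (rule sets_resolvent_measure[OF Q X rc lambda])
  have fin: "finite_measure \<mu>"
    unfolding \<mu>_def by (rule finite_resolvent_measure[OF Q X rc lambda])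
  \<comment> \<open>Full support of \<mu>: an uncharged ball would be avoided by almost every path
    at all times, contrary to the martingale problem.\<close>
  have pos: "0 < emeasure \<mu> (ball x r)" if "r > 0" for x r
  proof (rule ccontr)
    assume "\<not> 0 < emeasure \<mu> (ball x r)"
    then have "emeasure (resolvent_measure (P x0) X lam) (ball x r) = 0"
      unfolding \<mu>_def by (simp add: not_gr_zero)
    from AE_avoids_null_open_set[OF Q X rc lambda open_ball this]
    have "AE \<omega> in P x0. \<forall>t\<ge>0. X t \<omega> \<notin> ball x r" .
    moreover have "\<not> (AE \<omega> in P x0. \<forall>t\<ge>0. X t \<omega> \<notin> ball x r)"
      by (rule not_AE_avoids_ball[OF n_measurable n_pos n_upper' n_cont _ _ mollifier
            martingale_problem F0 rc that]) (use kappa alpha in \<open>auto simp: \<beta>_def\<close>)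
    ultimately show False by contradiction
  qed
  have bounded: "\<bar>n y h\<bar> \<le> inverse \<kappa> * norm h powr (- \<beta>)" for y
    using n_pos[OF h, of y] n_upper'[OF h, of y] by simp
  \<comment> \<open>Measurability in the first argument follows from continuity;
    \<open>n_measurable\<close> concerns the jump variable.\<close>
  have meas: "(\<lambda>y. n y h) \<in> borel_measurable borel"
    using n_cont[OF h] by (intro borel_measurable_continuous_onI continuous_at_imp_continuous_on) simp
  show ?thesis
    unfolding mollified_kernel_def \<mu>_def[symmetric]
    \<comment> \<open>The convergence is obtained at every \<open>x\<close>, and
      \<open>AE_I2\<close> weakens it to almost every \<open>x\<close>.\<close>
    by (intro AE_I2 mollified_average_tendsto[OF fin sets_\<mu> mollifier meas bounded n_cont[OF h] pos])
qed

end
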